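(* Let $(X,d)$ be a cone metric space over a real Banach space $E$ with cone $P$, let $I$ be an admissible ideal in $\mathbb{N}$ having the property (AP), and let $r\in E$ with $0\ll r$ or $r=0$. If a sequence $\{x_n\}$ in $X$ is rough $I$-convergent of roughness degree $r$ to $x^*\in X$, then $\{x_n\}$ is also rough $I^*$-convergent of the same roughness degree $r$ to $x^*$.
   Context: Let $E$ be a real Banach space with zero element $0$. A subset $P\subset E$ is a cone if (i) $P$ is closed, nonempty and $P\neq\{0\}$; (ii) $ax+by\in P$ for all $x,y\in P$ and real $a,b\ge 0$; (iii) $x\in P$ and $-x\in P$ imply $x=0$. For $x,y\in E$: $x\le y$ means $y-x\in P$; $x<y$ means $x\le y$ and $x\ne y$; $x\ll y$ means $y-x\in\operatorname{int}P$. A cone metric space $(X,d)$ is a nonempty set $X$ with a map $d:X\times X\to E$ such that $0\le d(x,y)$, $d(x,y)=0$ iff $x=y$, $d(x,y)=d(y,x)$, and $d(x,y)\le d(x,z)+d(z,y)$ for all $x,y,z\in X$. An ideal $I$ in $\mathbb{N}$ is a family of subsets of $\mathbb{N}$ closed under finite unions and under taking subsets; it is admissible if $I\ne\{\emptyset\}$, $\mathbb{N}\notin I$, and $\{n\}\in I$ for each $n\in\mathbb{N}$. Its associated filter is $F(I)=\{\mathbb{N}\setminus A: A\in I\}$. An admissible ideal $I$ has the property (AP) if for every sequence $A_1,A_2,\dots$ of mutually disjoint sets in $I$ there is a sequence $B_1,B_2,\dots$ of subsets of $\mathbb{N}$ such that $A_i\Delta B_i$ is finite for each $i$ and $\bigcup_{j\in\mathbb{N}}B_j\in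 I$. A sequence $\{x_n\}$ in $X$ is rough $I$-convergent of roughness degree $r$ to $x\in X$ (where $0\ll r$ or $r=0$) if for every $\varepsilon\in E$ with $0\ll\varepsilon$ the set $\{n\in\mathbb{N}: r+\varepsilon-d(x_n,x)\notin\operatorname{int}P\}$ belongs to $I$. It is rough $I^*$-convergent of roughness degree $r$ to $x$ if there is a set $M=\{m_1<m_2<\cdots<m_k<\cdots\}\in F(I)$ such that for every $\varepsilon\in E$ with $0\ll\varepsilon$ there is $k\in\mathbb{N}$ with $d(x_{m_p},x)\ll r+\varepsilon$ for all $p\ge k$. *)

theory Defs
  imports "HOL-Analysis.Analysis"
begin

text \<open>The ordering cone of a Banach space. This is not the library predicate \<open>cone\<close>, which only
  asks for closure under nonnegative scaling. The interior of the cone may be empty.\<close>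

definition banach_cone :: "'e::banach set \<Rightarrow> bool" where
  "banach_cone P \<longleftrightarrow>
     closed P \<and> P \<noteq> {} \<and> P \<noteq> {0} \<and>
     (\<forall>x\<in>P. \<forall>y\<in>P. \<forall>a b :: real. 0 \<le> a \<and> 0 \<le> b \<longrightarrow> a *\<^sub>R x + b *\<^sub>R y \<in> P) \<and>
     (\<forall>x. x \<in> P \<and> - x \<in> P \<longrightarrow> x = 0)"

definition cone_le :: "'e::banach set \<Rightarrow> 'e \<Rightarrow> 'e \<Rightarrow> bool" where
  "cone_le P x y \<longleftrightarrow> y - x \<in> P"

definition cone_ll :: "'e::banach set \<Rightarrow> 'e \<Rightarrow> 'e \<Rightarrow> bool" where
  "cone_ll P x y \<longleftrightarrow> y - x \<in> interior P"

definition cone_metric_space :: "'e::banach set \<Rightarrow> 'x set \<Rightarrow> ('x \<Rightarrow> 'x \<Rightarrow> 'e) \<Rightarrow> bool" where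
  "cone_metric_space P X d \<longleftrightarrow>
     X \<noteq> {} \<and>
     (\<forall>x\<in>X. \<forall>y\<in>X. cone_le P 0 (d x y)) \<and>
     (\<forall>x\<in>X. \<forall>y\<in>X. d x y = 0 \<longleftrightarrow> x = y) \<and>
     (\<forall>x\<in>X. \<forall>y\<in>X. d x y = d y x) \<and>
     (\<forall>x\<in>X. \<forall>y\<in>X. \<forall>z\<in>X. cone_le P (d x y) (d x z + d z y))"

text \<open>The empty set belongs to every ideal as the union of the empty subfamily.\<close>

definition nat_ideal :: "nat set set \<Rightarrow> bool" where
  "nat_ideal I \<longleftrightarrow>
     {} \<in> I \<and>
     (\<forall>A\<in>I. \<forall>B\<in>I. A \<union> B \<in> I) \<and>
     (\<forall>A\<in>I. \<forall>B. B \<subseteq> A \<longrightarrow> B \<in> I)"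

definition admissible_ideal :: "nat set set \<Rightarrow> bool" where
  "admissible_ideal I \<longleftrightarrow>
     nat_ideal I \<and> I \<noteq> {{}} \<and> UNIV \<notin> I \<and> (\<forall>n. {n} \<in> I)"

definition ideal_filter :: "nat set set \<Rightarrow> nat set set" where
  "ideal_filter I = {UNIV - A | A. A \<in> I}"

text \<open>Members of a \<open>disjoint_family\<close> may be empty, so finite disjoint families are covered too.\<close>

definition property_AP :: "nat set set \<Rightarrow> bool" where
  "property_AP I \<longleftrightarrow>
     (\<forall>A :: nat \<Rightarrow> nat set. (\<forall>i. A i \<in> I) \<and> disjoint_family A \<longrightarrow>
        (\<exists>B :: nat \<Rightarrow> nat set.
           (\<forall>i. finite ((A i - B i) \<union> (B i - A i))) \<and> (\<Union>j. B j) \<in> I))"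

definition rough_I_convergent ::
  "'e::banach set \<Rightarrow> ('x \<Rightarrow> 'x \<Rightarrow> 'e) \<Rightarrow> nat set set \<Rightarrow> 'e \<Rightarrow> (nat \<Rightarrow> 'x) \<Rightarrow> 'x \<Rightarrow> bool" where
  "rough_I_convergent P d I r x l \<longleftrightarrow>
     (\<forall>\<epsilon>. cone_ll P 0 \<epsilon> \<longrightarrow> {n. r + \<epsilon> - d (x n) l \<notin> interior P} \<in> I)"

text \<open>The set \<open>M = {m\<^sub>1 < m\<^sub>2 < \<dots>}\<close> is given by its strictly increasing enumeration \<open>m\<close>.
  It is chosen before \<open>\<epsilon>\<close>.\<close>

definition rough_I_star_convergent ::
  "'e::banach set \<Rightarrow> ('x \<Rightarrow> 'x \<Rightarrow> 'e) \<Rightarrow> nat set set \<Rightarrow> 'e \<Rightarrow> (nat \<Rightarrow> 'x) \<Rightarrow> 'x \<Rightarrow> bool" where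
  "rough_I_star_convergent P d I r x l \<longleftrightarrow>
     (\<exists>m :: nat \<Rightarrow> nat. strict_mono m \<and> range m \<in> ideal_filter I \<and>
        (\<forall>\<epsilon>. cone_ll P 0 \<epsilon> \<longrightarrow> (\<exists>k. \<forall>p\<ge>k. cone_ll P (d (x (m p)) l) (r + \<epsilon>))))"

end

theory Submission
  imports Defs
begin

text \<open>Rough \<open>I\<close>-convergence provides an exceptional set in \<open>I\<close> for each \<open>\<epsilon>\<close>, whereas rough
  \<open>I\<^sup>*\<close>-convergence asks for one exceptional set that serves all \<open>\<epsilon>\<close>. Two reductions close the gap.

  First, countably many \<open>\<epsilon>\<close> suffice. If \<open>c\<close> is an interior point of the cone, then for every
  \<open>\<epsilon>\<close> with \<open>0 \<lless> \<epsilon>\<close> some \<open>c / (n + 1)\<close> satisfies \<open>c / (n + 1) \<lless> \<epsilon>\<close>, because \<open>c / (n + 1) \<longlonglongrightarrow> 0\<close> and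
  the interior is open (\<open>ex_scaled_cone_ll\<close>). A bound by \<open>r + c / (n + 1)\<close> is thus stronger than a
  bound by \<open>r + \<epsilon>\<close>.

  Second, property (AP) makes \<open>I\<close> a P-ideal: any countable family in \<open>I\<close> is contained, up to finite
  sets, in a single member \<open>U\<close> of \<open>I\<close> (\<open>property_AP_almost_cover\<close>). The subsequence over the
  complement of \<open>U\<close> meets the exceptional set of each \<open>c / (n + 1)\<close> only finitely often, so each of
  these bounds holds eventually along it.

  If the cone has empty interior, no \<open>\<epsilon>\<close> satisfies \<open>0 \<lless> \<epsilon>\<close> and the whole sequence serves
  vacuously.\<close>

text \<open>The translate of the interior by an element of the cone is an open subset of the cone.\<close>

lemma banach_cone_interior_add:
  assumes "banach_cone P" and "u \<in> interior P" and "v \<in> P"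
  shows "v + u \<in> interior P"
proof -
  have closed_add: "a + b \<in> P" if "a \<in> P" "b \<in> P" for a b
  proof -
    have "1 *\<^sub>R a + 1 *\<^sub>R b \<in> P"
      using assms(1) that unfolding banach_cone_def by (meson zero_le_one)
    then show ?thesis by simp
  qed
  have "(+) v ` interior P \<subseteq> interior P"
  proof (rule interior_maximal)
    show "(+) v ` interior P \<subseteq> P"
      using closed_add assms(3) interior_subset by blast
    show "open ((+) v ` interior P)"
      by (rule open_translation) simp
  qed
  then show ?thesis using assms(2) by blast
qed

lemma cone_ll_trans:
  assumes "banach_cone P" and "cone_ll P a b" and "cone_ll P b c"
  shows "cone_ll P a c"
proof -
  have "(b - a) + (c - b) \<in> interior P"
    using assms interior_subset unfolding cone_ll_def
    by (blast intro: banach_cone_interior_add)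
  then show ?thesis by (simp add: cone_ll_def)
qed

lemma ex_scaled_cone_ll:
  assumes "cone_ll P 0 \<epsilon>"
  shows "\<exists>n. cone_ll P (inverse (real (Suc n)) *\<^sub>R c) \<epsilon>"
proof -
  have "(\<lambda>n. \<epsilon> - inverse (real (Suc n)) *\<^sub>R c) \<longlonglongrightarrow> \<epsilon> - 0 *\<^sub>R c"
    by (intro tendsto_intros LIMSEQ_inverse_real_of_nat)
  moreover have "\<epsilon> - 0 *\<^sub>R c \<in> interior P"
    using assms by (simp add: cone_ll_def)
  ultimately have "\<forall>\<^sub>F n in sequentially. \<epsilon> - inverse (real (Suc n)) *\<^sub>R c \<in> interior P"
    by (rule topological_tendstoD[OF _ open_interior])
  then show ?thesis
    unfolding cone_ll_def by (blast dest: eventually_happens'[OF sequentially_bot])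
qed

lemma scaleR_interior_banach_cone:
  assumes "banach_cone P" and "c \<in> interior P" and "0 < t"
  shows "t *\<^sub>R c \<in> interior P"
proof -
  have scaled: "t *\<^sub>R a \<in> P" if "a \<in> P" for a
  proof -
    have "t *\<^sub>R a + 0 *\<^sub>R a \<in> P"
      using assms(1,3) that unfolding banach_cone_def by (meson less_imp_le order_refl)
    then show ?thesis by simp
  qed
  have "(*\<^sub>R) t ` interior P \<subseteq> interior P"
  proof (rule interior_maximal)
    show "(*\<^sub>R) t ` interior P \<subseteq> P"
      using scaled interior_subset by blast
    show "open ((*\<^sub>R) t ` interior P)"
      using assms(3) by (intro open_scaling) auto
  qed
  then show ?thesis using assms(2) by blast
qed

lemma finite_in_admissible_ideal:
  assumes "admissible_ideal I" and "finite F"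
  shows "F \<in> I"
  using assms(2)
proof induction
  case empty
  then show ?case using assms(1) by (simp add: admissible_ideal_def nat_ideal_def)
next
  case (insert a F)
  then have "{a} \<union> F \<in> I"
    using assms(1) unfolding admissible_ideal_def nat_ideal_def by blast
  then show ?case by simp
qed

lemma infinite_Compl_admissible_ideal:
  assumes "admissible_ideal I" and "U \<in> I"
  shows "infinite (- U)"
proof
  assume "finite (- U)"
  then have "- U \<in> I" by (rule finite_in_admissible_ideal[OF assms(1)])
  with assms have "U \<union> - U \<in> I" unfolding admissible_ideal_def nat_ideal_def by blast
  with assms(1) show False by (simp add: admissible_ideal_def)
qed

text \<open>Property (AP) speaks of disjoint families, so it is applied to the sets
  \<open>A n - (\<Union>i<n. A i)\<close>. These lie in \<open>I\<close>, and finitely many of them still cover each \<open>A n\<close>.\<close>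

lemma property_AP_almost_cover:
  fixes A :: "nat \<Rightarrow> nat set"
  assumes "nat_ideal I" and "property_AP I" and A: "\<And>n. A n \<in> I"
  shows "\<exists>U\<in>I. \<forall>n. finite (A n - U)"
proof -
  have "disjointed A n \<in> I" for n
    using assms(1) A[of n] disjointed_subset[of A n] unfolding nat_ideal_def by blast
  then obtain B where B: "\<And>i. finite ((disjointed A i - B i) \<union> (B i - disjointed A i))"
    and U: "(\<Union>j. B j) \<in> I"
    using assms(2) disjoint_family_disjointed[of A] unfolding property_AP_def by blast
  have "finite (A n - (\<Union>j. B j))" for n
  proof (rule finite_subset)
    have "A n \<subseteq> (\<Union>i\<in>{0..<Suc n}. disjointed A i)"
      unfolding finite_UN_disjointed_eq by auto
    then show "A n - (\<Union>j. B j) \<subseteq> (\<Union>i\<in>{0..<Suc n}. disjointed A i - B i)"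
      by blast
    show "finite (\<Union>i\<in>{0..<Suc n}. disjointed A i - B i)"
      using B by auto
  qed
  with U show ?thesis by blast
qed

lemma strict_mono_eventually_avoids_finite:
  fixes m :: "nat \<Rightarrow> nat"
  assumes "strict_mono m" and "finite F"
  shows "\<exists>k. \<forall>p\<ge>k. m p \<notin> F"
proof -
  have "finite (m -` F)"
    using assms by (intro finite_vimageI strict_mono_imp_inj_on)
  then obtain k where "\<forall>p\<in>m -` F. p < k"
    using finite_nat_set_iff_bounded by blast
  then show ?thesis by (metis not_le vimageI)
qed

theorem theorem3p13:
  fixes P :: "'e::banach set"
    and X :: "'x set"
    and d :: "'x \<Rightarrow> 'x \<Rightarrow> 'e"
    and I :: "nat set set"
    and r :: 'e
    and x :: "nat \<Rightarrow> 'x"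
    and xstar :: 'x
  assumes "banach_cone P"
    and "cone_metric_space P X d"
    and "admissible_ideal I"
    and "property_AP I"
    and "cone_ll P 0 r \<or> r = 0"
    and "\<And>n. x n \<in> X"
    and "xstar \<in> X"
    and "rough_I_convergent P d I r x xstar"
  shows "rough_I_star_convergent P d I r x xstar"
proof (cases "interior P = {}")
  case True
  have "{} \<in> I" using assms(3) by (simp add: admissible_ideal_def nat_ideal_def)
  then have "range (id :: nat \<Rightarrow> nat) \<in> ideal_filter I"
    unfolding ideal_filter_def by force
  moreover have "strict_mono (id :: nat \<Rightarrow> nat)" by (simp add: strict_mono_def)
  ultimately show ?thesis
    using True unfolding rough_I_star_convergent_def cone_ll_def by blast
next
  case False
  then obtain c where c: "c \<in> interior P" by blast
  define e where "e n = inverse (real (Suc n)) *\<^sub>R c" for n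
  define A where "A n = {j. r + e n - d (x j) xstar \<notin> interior P}" for n
  have "cone_ll P 0 (e n)" for n
    unfolding cone_ll_def e_def diff_0_right
    by (rule scaleR_interior_banach_cone[OF assms(1) c]) simp
  then have "A n \<in> I" for n
    using assms(8) unfolding rough_I_convergent_def A_def by blast
  moreover have "nat_ideal I" using assms(3) by (simp add: admissible_ideal_def)
  ultimately obtain U where U: "U \<in> I" and fin: "\<And>n. finite (A n - U)"
    using property_AP_almost_cover[OF _ assms(4)] by blast
  have inf: "infinite (- U)" by (rule infinite_Compl_admissible_ideal[OF assms(3) U])
  define m where "m = enumerate (- U)"
  have mono: "strict_mono m" and range_m: "range m = UNIV - U"
    using inf by (simp_all add: m_def strict_mono_enumerate range_enumerate Compl_eq_Diff_UNIV)
  have "\<exists>k. \<forall>p\<ge>k. cone_ll P (d (x (m p)) xstar) (r + \<epsilon>)" if \<epsilon>: "cone_ll P 0 \<epsilon>" for \<epsilon>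
  proof -
    obtain n where n: "cone_ll P (e n) \<epsilon>"
      using ex_scaled_cone_ll[OF \<epsilon>] unfolding e_def by blast
    obtain k where k: "\<And>p. p \<ge> k \<Longrightarrow> m p \<notin> A n - U"
      using strict_mono_eventually_avoids_finite[OF mono fin] by blast
    have "cone_ll P (d (x (m p)) xstar) (r + \<epsilon>)" if "p \<ge> k" for p
    proof (rule cone_ll_trans[OF assms(1)])
      have "m p \<notin> U" using range_m by blast
      with k[OF that] show "cone_ll P (d (x (m p)) xstar) (r + e n)"
        by (simp add: A_def cone_ll_def)
      show "cone_ll P (r + e n) (r + \<epsilon>)"
        using n by (simp add: cone_ll_def)
    qed
    then show ?thesis by blast
  qed
  moreover have "range m \<in> ideal_filter I"
    using U range_m unfolding ideal_filter_def by blast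
  ultimately show ?thesis
    using mono unfolding rough_I_star_convergent_def by blast
qed

end
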